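(* Let $d\ge2$, $\lambda,\mu>0$, $\rho=\lambda/\mu$, and consider the network process $(\mathcal{A}^N(t))$ described in the context. If $$L^N(t)=\sum_{f\in\mathcal{F}_N}\mathbf{1}_{\{\mathcal{A}^N_f(t)\not=\emptyset\}}$$ is the number of files alive at time $t$, then there exists a constant $K_1>0$ such that, for all $t\geq0$, $$\limsup_{N\to+\infty}\mathbb{E}\left(\frac{L^N(t)}{N}\right)\leq K_1e^{-\mu\kappa_d^+(\rho)t},$$ where $-\kappa_d^+(\rho)$ is the largest eigenvalue of the $d\times d$ matrix $M_\rho$ defined in the context.
   Context: **The network.** There are $N\ge d$ nodes and a set $\mathcal{F}_N$ of $F_N$ files, with $F_N/N\to\beta\in(0,\infty)$ as $N\to\infty$. For $f\in\mathcal{F}_N$, $\mathcal{A}^N_f(t)\subset\{1,\dots,N\}$ is the set of nodes having a copy of $f$ at time $t$, $c^N_f(t)=\mathrm{card}(\mathcal{A}^N_f(t))\le d$, and $\mathcal{A}^N(t)=(\mathcal{A}^N_f(t),f\in\mathcal{F}_N)$ is a Markov process with the following dynamics. - Initial state: independently for each $f$, $\mathcal{A}^N_f(0)$ is a uniformly random subset of $\{1,\dots,N\}$ with $d$ elements. - Failures: each node $i$ fails at rate $\mu$, independently of the other nodes; $i$ is then removed from all the sets $\mathcal{A}^N_f$ (all its copies are lost simultaneously) and the node restarts empty. - Duplication: each node $i$ holding at least one copy, at rate $\lambda$, considers the files $f$ with $i\in\mathcal{A}^N_f$ for which $c^N_f$ is minimal among the files present on $i$; if this minimal value is strictly less than $d$,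 one of these files is chosen uniformly at random and a new copy of it is made on a node chosen uniformly at random in $\{1,\dots,N\}$, which is added to the corresponding set $\mathcal{A}^N_f$ (if this node already has a copy of $f$, $\mathcal{A}^N_f$ is unchanged). **The matrix.** $M_\rho=(m_{k,l})_{1\le k,l\le d}$ is tridiagonal with $m_{k,k}=-k(\rho+1)$ for $1\le k<d$, $m_{d,d}=-d$, $m_{k,k-1}=k\rho$ for $2\le k\le d$, $m_{k,k+1}=k$ for $1\le k<d$, and all other entries $0$. It has $d$ distinct negative eigenvalues. *)

theory Defs
  imports "HOL-Probability.Probability" "Jordan_Normal_Form.Char_Poly"
begin

section \<open>Continuous-time Markov processes on a finite state space\<close>

text \<open>
  \<open>q x y\<close> is the jump rate from \<open>x\<close> to \<open>y \<noteq> x\<close>; diagonal values of \<open>q\<close> are ignored.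
  As \<open>S\<close> is finite, the off-diagonal derivatives at time 0 together with the semigroup
  property determine \<open>P t x\<close> for all \<open>x \<in> S\<close> and \<open>t \<ge> 0\<close>.
\<close>

definition transition_semigroup ::
    "'s set \<Rightarrow> ('s \<Rightarrow> 's \<Rightarrow> real) \<Rightarrow> (real \<Rightarrow> 's \<Rightarrow> 's pmf) \<Rightarrow> bool" where
  "transition_semigroup S q P \<longleftrightarrow>
     (\<forall>x\<in>S. P 0 x = return_pmf x) \<and>
     (\<forall>x\<in>S. \<forall>t\<ge>0. set_pmf (P t x) \<subseteq> S) \<and>
     (\<forall>x\<in>S. \<forall>s\<ge>0. \<forall>t\<ge>0. P (s + t) x = bind_pmf (P s x) (P t)) \<and>
     (\<forall>x\<in>S. \<forall>y\<in>S. x \<noteq> y \<longrightarrow> ((\<lambda>h. pmf (P h x) y / h) \<longlongrightarrow> q x y) (at_right 0))"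

definition past_events :: "'w measure \<Rightarrow> (real \<Rightarrow> 'w \<Rightarrow> 's) \<Rightarrow> real \<Rightarrow> 'w set set" where
  "past_events M X s = sigma_sets (space M) {X u -` B \<inter> space M | u B. 0 \<le> u \<and> u \<le> s}"

text \<open>
  The last condition is right-continuity of the paths for the discrete topology on \<open>S\<close>.
\<close>

definition markov_jump_process ::
    "'s set \<Rightarrow> ('s \<Rightarrow> 's \<Rightarrow> real) \<Rightarrow> 's pmf \<Rightarrow> 'w measure \<Rightarrow> (real \<Rightarrow> 'w \<Rightarrow> 's) \<Rightarrow> bool" where
  "markov_jump_process S q \<nu> M X \<longleftrightarrow>
     finite S \<and> prob_space M \<and>
     (\<forall>t\<ge>0. X t \<in> measurable M (count_space UNIV) \<and> X t \<in> space M \<rightarrow> S) \<and>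
     distr M (count_space UNIV) (X 0) = measure_pmf \<nu> \<and>
     (\<exists>P. transition_semigroup S q P \<and>
        (\<forall>s\<ge>0. \<forall>h\<ge>0. \<forall>E\<in>past_events M X s. \<forall>x\<in>S. \<forall>y\<in>S.
           measure M (E \<inter> {\<omega> \<in> space M. X s \<omega> = x \<and> X (s + h) \<omega> = y}) =
           measure M (E \<inter> {\<omega> \<in> space M. X s \<omega> = x}) * pmf (P h x) y)) \<and>
     (AE \<omega> in M. \<forall>t\<ge>0. \<forall>\<^sub>F u in at_right t. X u \<omega> = X t \<omega>)"

section \<open>The storage network\<close>

text \<open>
  A configuration maps each file to the set of nodes holding a copy of it; it is \<open>{}\<close> outside
  the set \<open>Fs\<close> of files, so that configurations are determined by their values on \<open>Fs\<close>.
\<close>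

type_synonym 'f config = "'f \<Rightarrow> nat set"

definition configs :: "nat \<Rightarrow> nat \<Rightarrow> 'f set \<Rightarrow> 'f config set" where
  "configs d N Fs = PiE_dflt Fs {} (\<lambda>_. {B. B \<subseteq> {1..N} \<and> card B \<le> d})"

definition initial_config :: "nat \<Rightarrow> nat \<Rightarrow> 'f set \<Rightarrow> 'f config pmf" where
  "initial_config d N Fs =
     Pi_pmf Fs {} (\<lambda>_. pmf_of_set {B. B \<subseteq> {1..N} \<and> card B = d})"

definition fail_node :: "nat \<Rightarrow> 'f config \<Rightarrow> 'f config" where
  "fail_node i A = (\<lambda>f. A f - {i})"

definition least_replicated :: "'f set \<Rightarrow> 'f config \<Rightarrow> nat \<Rightarrow> 'f set" where
  "least_replicated Fs A i = {f. is_arg_min (\<lambda>g. card (A g)) (\<lambda>g. g \<in> Fs \<and> i \<in> A g) f}"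

text \<open>
  All files in \<open>least_replicated Fs A i\<close> have the same number of copies, so the test below
  compares the minimal number of copies with \<open>d\<close>.
\<close>

definition duplicate_from :: "nat \<Rightarrow> nat \<Rightarrow> 'f set \<Rightarrow> 'f config \<Rightarrow> nat \<Rightarrow> 'f config pmf" where
  "duplicate_from d N Fs A i =
     (if \<exists>f\<in>least_replicated Fs A i. card (A f) < d
      then bind_pmf (pmf_of_set (least_replicated Fs A i)) (\<lambda>f.
           bind_pmf (pmf_of_set {1..N}) (\<lambda>j.
           return_pmf (A(f := insert j (A f)))))
      else return_pmf A)"

definition network_rate ::
    "nat \<Rightarrow> real \<Rightarrow> real \<Rightarrow> nat \<Rightarrow> 'f set \<Rightarrow> 'f config \<Rightarrow> 'f config \<Rightarrow> real" where
  "network_rate d lam mu N Fs A B =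
     (\<Sum>i\<in>{1..N}. mu * of_bool (fail_node i A = B)) +
     (\<Sum>i\<in>{i\<in>{1..N}. \<exists>f\<in>Fs. i \<in> A f}. lam * pmf (duplicate_from d N Fs A i) B)"

definition network_process ::
    "nat \<Rightarrow> real \<Rightarrow> real \<Rightarrow> nat \<Rightarrow> 'f set \<Rightarrow> 'w measure \<Rightarrow> (real \<Rightarrow> 'w \<Rightarrow> 'f config) \<Rightarrow> bool" where
  "network_process d lam mu N Fs M X \<longleftrightarrow>
     markov_jump_process (configs d N Fs) (network_rate d lam mu N Fs)
       (initial_config d N Fs) M X"

definition alive_files :: "'f set \<Rightarrow> 'f config \<Rightarrow> real" where
  "alive_files Fs A = (\<Sum>f\<in>Fs. of_bool (A f \<noteq> {}))"

section \<open>The matrix\<close>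

text \<open>
  Matrix indices start at 0, hence the shift.
\<close>

definition M_rho :: "nat \<Rightarrow> real \<Rightarrow> real mat" where
  "M_rho d \<rho> = mat d d (\<lambda>(i, j). let k = i + 1; l = j + 1 in
     if l = k then (if k < d then - real k * (\<rho> + 1) else - real d)
     else if k = l + 1 then real k * \<rho>
     else if l = k + 1 then real k
     else 0)"

text \<open>
  For \<open>\<rho> > 0\<close> and \<open>d \<ge> 1\<close> the matrix has \<open>d\<close> distinct eigenvalues, all of them real, so the
  maximum is over a nonempty finite set that contains the whole (complex) spectrum.
\<close>

definition kappa_plus :: "nat \<Rightarrow> real \<Rightarrow> real" where
  "kappa_plus d \<rho> = - Max {x. eigenvalue (M_rho d \<rho>) x}"

end

theory Submission
  imports Defs
begin

text \<open>
  Each node that holds a file makes copies at rate \<open>\<lambda>\<close>, which may be copies of other files. So a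
  file with \<open>k\<close> copies is duplicated at rate at most \<open>\<lambda> k\<close>, while it loses a copy at rate exactly
  \<open>\<mu> k\<close>.
  The number of its copies is therefore dominated by the birth and death process on
  \<open>{0, \<dots>, d}\<close>, absorbed at \<open>0\<close>, with birth rates \<open>\<lambda> k\<close> for \<open>k < d\<close> and death rates \<open>\<mu> k\<close>.
  In units of \<open>1 / \<mu>\<close>, and apart from the absorbing state, the generator of that process is
  \<open>M\<^sub>\<rho>\<close> up to conjugation by the diagonal matrix with entries \<open>\<rho>\<^sup>k\<close>.

  The domination needs no coupling. Suppose that \<open>w\<close> is an eigenfunction of the birth and death
  generator, with \<open>w 0 = 0\<close>, \<open>w 1 = 1\<close> and eigenvalue \<open>- s\<close>. If \<open>w\<close> is also nondecreasing, then a
  smaller birth rate only decreases the drift of \<open>w\<close>, and so \<open>w\<close>, evaluated at the number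
  of copies of a file, has drift at most \<open>- \<mu> s w\<close> in the network, whatever the other
  files do (lemma \<open>network_drift_le\<close>). A Lyapunov argument turns this into
  \<open>E w \<le> w d * exp (- \<mu> s t)\<close> (lemma \<open>markov_jump_process_exp_decay\<close>). As \<open>w \<ge> 1\<close> at all numbers
  of copies other than \<open>0\<close>, each file is alive with at most that probability; summation over the
  files and \<open>F\<^sub>N / N \<longlonglongrightarrow> \<beta>\<close> give the result with \<open>K\<^sub>1 = \<beta> * w d\<close>.

  A nondecreasing eigenfunction is obtained by solving the eigenvalue equation recursively from
  \<open>w 0 = 0\<close>, \<open>w 1 = 1\<close> and increasing \<open>s\<close> from \<open>0\<close> until an increment first vanishes: this must be
  the increment from \<open>d\<close> to \<open>d + 1\<close>, which is the boundary condition at \<open>d\<close>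
  (lemma \<open>increasing_bd_eigen_exists\<close>). Then \<open>- s\<close> is an eigenvalue of \<open>M\<^sub>\<rho>\<close>, hence at most the
  largest one \<open>- \<kappa>\<close>, and decay at rate \<open>\<mu> s\<close> implies decay at rate \<open>\<mu> \<kappa>\<close>.
\<close>

section \<open>An increasing eigenvector of the birth and death matrix\<close>

text \<open>
  The solution \<open>w\<close> of \<open>k \<rho> (w (k + 1) - w k) + k (w (k - 1) - w k) = - s w k\<close> for all \<open>k \<ge> 1\<close> with
  \<open>w 0 = 0\<close> and \<open>w 1 = 1\<close>, that is, an eigenfunction of the linear birth and death process that is
  killed at \<open>0\<close> and has no upper boundary. Births at \<open>d\<close> may be suppressed
  without changing the equation when \<open>w (d + 1) = w d\<close>.
\<close>

fun bd_eigen :: "real \<Rightarrow> real \<Rightarrow> nat \<Rightarrow> real" where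
  "bd_eigen \<rho> s 0 = 0"
| "bd_eigen \<rho> s (Suc 0) = 1"
| "bd_eigen \<rho> s (Suc (Suc k)) = bd_eigen \<rho> s (Suc k) +
     (bd_eigen \<rho> s (Suc k) - bd_eigen \<rho> s k - s * bd_eigen \<rho> s (Suc k) / real (Suc k)) / \<rho>"

lemma bd_eigen_generator:
  assumes "\<rho> > 0" and "k > 0"
  shows "real k * \<rho> * (bd_eigen \<rho> s (Suc k) - bd_eigen \<rho> s k)
       + real k * (bd_eigen \<rho> s (k - 1) - bd_eigen \<rho> s k) = - s * bd_eigen \<rho> s k"
proof -
  obtain j where "k = Suc j" using assms(2) gr0_implies_Suc by blast
  then have "\<rho> * (bd_eigen \<rho> s (Suc k) - bd_eigen \<rho> s k)
      = bd_eigen \<rho> s k - bd_eigen \<rho> s (k - 1) - s * bd_eigen \<rho> s k / real k"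
    using assms(1) by simp
  then have "real k * (\<rho> * (bd_eigen \<rho> s (Suc k) - bd_eigen \<rho> s k))
      = real k * (bd_eigen \<rho> s k - bd_eigen \<rho> s (k - 1)) - s * bd_eigen \<rho> s k"
    using assms(2) by (simp add: right_diff_distrib)
  then show ?thesis by (simp add: algebra_simps)
qed

lemma continuous_on_bd_eigen: "continuous_on A (\<lambda>s. bd_eigen \<rho> s k)"
proof (induction \<rho> "0::real" k rule: bd_eigen.induct)
  case (3 \<rho> k)
  then show ?case
    unfolding bd_eigen.simps divide_inverse by (intro continuous_intros)
qed simp_all

lemma bd_eigen_increment_pos_at_0:
  assumes "\<rho> > 0"
  shows "bd_eigen \<rho> 0 k < bd_eigen \<rho> 0 (Suc k)"
  using assms by (induction k) simp_all

lemma bd_eigen_ge_1: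
  assumes "\<And>k. k < n \<Longrightarrow> bd_eigen \<rho> s k \<le> bd_eigen \<rho> s (Suc k)" and "n > 0"
  shows "bd_eigen \<rho> s n \<ge> 1"
  using assms
proof (induction n)
  case (Suc n)
  show ?case
  proof (cases "n = 0")
    case False
    then have "1 \<le> bd_eigen \<rho> s n" using Suc by simp
    also have "\<dots> \<le> bd_eigen \<rho> s (Suc n)" using Suc.prems by simp
    finally show ?thesis .
  qed simp
qed simp

text \<open>
  At \<open>s = 0\<close> all increments are positive; at \<open>s = 1\<close> the second one vanishes. At the smallest \<open>s\<close>
  for which one of the first \<open>d + 1\<close> increments is not positive, all of them are still
  nonnegative by continuity, so that \<open>w \<ge> 1\<close> from \<open>1\<close> on. If the increment from \<open>k\<close> to \<open>k + 1\<close>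
  vanishes there, the recursion makes the next increment negative, so \<open>k\<close> must be \<open>d\<close>.
\<close>

lemma increasing_bd_eigen_exists:
  assumes \<rho>: "\<rho> > 0" and d: "d > 0"
  obtains s where "s > 0" "\<And>k. k \<le> d \<Longrightarrow> bd_eigen \<rho> s k \<le> bd_eigen \<rho> s (Suc k)"
    "bd_eigen \<rho> s (Suc d) = bd_eigen \<rho> s d"
proof -
  define Z where "Z = (\<Union>k\<in>{..d}. {s\<in>{0..1}. bd_eigen \<rho> s (Suc k) \<le> bd_eigen \<rho> s k})"
  have "closed Z"
    unfolding Z_def
    by (intro closed_UN ballI continuous_on_closed_Collect_le continuous_on_bd_eigen) auto
  moreover have "Z \<subseteq> {0..1}"
    unfolding Z_def by auto
  ultimately have "compact Z"
    by (meson bounded_closed_interval bounded_subset compact_eq_bounded_closed)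
  moreover have "1 \<in> Z"
    using d unfolding Z_def by (auto intro!: bexI[of _ 1])
  ultimately obtain s where s: "s \<in> Z" and s_min: "\<And>r. r \<in> Z \<Longrightarrow> s \<le> r"
    using compact_attains_inf[of Z] by auto
  from s obtain k where k: "k \<le> d" "bd_eigen \<rho> s (Suc k) \<le> bd_eigen \<rho> s k" and s01: "s \<in> {0..1}"
    unfolding Z_def by auto
  have "s \<noteq> 0"
    using k bd_eigen_increment_pos_at_0[OF \<rho>, of k] by auto
  with s01 have s_pos: "s > 0" by simp
  have mono: "bd_eigen \<rho> s j \<le> bd_eigen \<rho> s (Suc j)" if j: "j \<le> d" for j
  proof -
    have "{0..<s} \<subseteq> {r\<in>{0..s}. bd_eigen \<rho> r j \<le> bd_eigen \<rho> r (Suc j)}"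
    proof
      fix r assume r: "r \<in> {0..<s}"
      then have "r \<notin> Z" using s_min[of r] by auto
      then show "r \<in> {r\<in>{0..s}. bd_eigen \<rho> r j \<le> bd_eigen \<rho> r (Suc j)}"
        using r j s01 unfolding Z_def by force
    qed
    then have "closure {0..<s} \<subseteq> {r\<in>{0..s}. bd_eigen \<rho> r j \<le> bd_eigen \<rho> r (Suc j)}"
      by (rule closure_minimal)
        (intro continuous_on_closed_Collect_le continuous_on_bd_eigen closed_atLeastAtMost)
    then have "{0..s} \<subseteq> {r\<in>{0..s}. bd_eigen \<rho> r j \<le> bd_eigen \<rho> r (Suc j)}"
      using s_pos by simp
    moreover have "s \<in> {0..s}" using s_pos by simp
    ultimately show ?thesis by blast
  qed
  have eq: "bd_eigen \<rho> s (Suc k) = bd_eigen \<rho> s k"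
    using k mono[of k] by simp
  have "k > 0" using eq by (cases k) auto
  have "k = d"
  proof (rule ccontr)
    assume "k \<noteq> d"
    with k have kd: "Suc k \<le> d" by simp
    have "bd_eigen \<rho> s (Suc k) \<ge> 1"
      by (rule bd_eigen_ge_1) (use mono kd in auto)
    then have "(bd_eigen \<rho> s (Suc k) - bd_eigen \<rho> s k - s * bd_eigen \<rho> s (Suc k) / real (Suc k)) / \<rho> < 0"
      using s_pos \<rho> eq by (simp add: divide_neg_pos)
    then have "bd_eigen \<rho> s (Suc (Suc k)) < bd_eigen \<rho> s (Suc k)"
      by simp
    with mono[OF kd] show False by simp
  qed
  with eq show ?thesis using that s_pos mono by blast
qed

text \<open>
  The vector \<open>\<rho>\<^sup>k w k\<close> is the eigenvector. Row \<open>k\<close> of \<open>M\<^sub>\<rho>\<close>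
  applied to it is \<open>\<rho>\<^sup>k\<close> times the generator equation at \<open>k\<close>; in row \<open>d\<close> the births are missing,
  which is where the closing condition at \<open>d\<close> enters.
\<close>

lemma eigenvalue_M_rho_bd_eigen:
  assumes \<rho>: "\<rho> > 0" and d: "d > 0" and eq: "bd_eigen \<rho> s (Suc d) = bd_eigen \<rho> s d"
  shows "eigenvalue (M_rho d \<rho>) (- s)"
proof -
  define v where "v = vec d (\<lambda>i. \<rho> ^ Suc i * bd_eigen \<rho> s (Suc i))"
  have "v $ 0 \<noteq> 0"
    using \<rho> d by (simp add: v_def)
  then have "v \<noteq> 0\<^sub>v d"
    using d by auto
  moreover have "M_rho d \<rho> *\<^sub>v v = (- s) \<cdot>\<^sub>v v"
  proof (rule eq_vecI)
    fix i assume "i < dim_vec ((- s) \<cdot>\<^sub>v v)"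
    then have i: "i < d" by (simp add: v_def)
    let ?w = "\<lambda>k. \<rho> ^ k * bd_eigen \<rho> s k" and ?k = "real (Suc i)"
    let ?diag = "if Suc i < d then - ?k * (\<rho> + 1) else - real d"
    have "(M_rho d \<rho> *\<^sub>v v) $ i = (\<Sum>j<d. M_rho d \<rho> $$ (i, j) * ?w (Suc j))"
      using i by (simp add: M_rho_def scalar_prod_def v_def lessThan_atLeast0)
    \<comment> \<open>The factor \<open>of_bool (i > 0)\<close> removes the lower neighbour in row \<open>0\<close>, where \<open>i - 1\<close> is \<open>0\<close> again.\<close>
    also have "\<dots> = (\<Sum>j<d. (if j = i then ?diag * ?w (Suc i) else 0)
                 + (if j = i - 1 then of_bool (i > 0) * (?k * \<rho> * ?w i) else 0)
                 + (if j = Suc i then ?k * ?w (Suc (Suc i)) else 0))"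
      using i by (intro sum.cong) (auto simp: M_rho_def Let_def)
    also have "\<dots> = ?diag * ?w (Suc i) + ?k * \<rho> * ?w i
                 + of_bool (Suc i < d) * (?k * ?w (Suc (Suc i)))"
      using i by (auto simp: sum.distrib)
    also have "\<dots> = \<rho> ^ Suc i * (?k * \<rho> * (bd_eigen \<rho> s (Suc (Suc i)) - bd_eigen \<rho> s (Suc i))
       + ?k * (bd_eigen \<rho> s (Suc i - 1) - bd_eigen \<rho> s (Suc i)))"
    proof (cases "Suc i < d")
      case True
      then show ?thesis by (simp del: bd_eigen.simps add: algebra_simps)
    next
      case False
      then have "d = Suc i" using i by simp
      then show ?thesis using eq by (simp del: bd_eigen.simps add: algebra_simps)
    qed
    also have "\<dots> = \<rho> ^ Suc i * (- s * bd_eigen \<rho> s (Suc i))"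
      by (subst bd_eigen_generator[OF \<rho>]) auto
    also have "\<dots> = ((- s) \<cdot>\<^sub>v v) $ i"
      using i by (simp add: v_def)
    finally show "(M_rho d \<rho> *\<^sub>v v) $ i = ((- s) \<cdot>\<^sub>v v) $ i" .
  qed (simp add: M_rho_def v_def)
  ultimately show ?thesis
    unfolding eigenvalue_def eigenvector_def
    by (intro exI[of _ v]) (simp add: M_rho_def v_def)
qed

lemma kappa_plus_le:
  assumes "eigenvalue (M_rho d \<rho>) (- s)"
  shows "kappa_plus d \<rho> \<le> s"
proof -
  have M: "M_rho d \<rho> \<in> carrier_mat d d"
    by (simp add: M_rho_def)
  have "char_poly (M_rho d \<rho>) \<noteq> 0"
    using degree_monic_char_poly[OF M] by auto
  then have "finite {x. eigenvalue (M_rho d \<rho>) x}"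
    unfolding eigenvalue_root_char_poly[OF M] by (rule poly_roots_finite)
  then have "- s \<le> Max {x. eigenvalue (M_rho d \<rho>) x}"
    using assms by (intro Max_ge) auto
  then show ?thesis by (simp add: kappa_plus_def)
qed

section \<open>Exponential decay from a drift condition\<close>

text \<open>
  The rates \<open>q\<close> are derivatives at time \<open>0\<close>, so the drift condition holds for the semigroup over
  short times up to an error \<open>\<epsilon> h\<close>, uniformly in the starting point because there are finitely
  many of them.
\<close>

lemma transition_semigroup_short_time:
  assumes P: "transition_semigroup S q P" and S: "finite S"
    and drift: "\<And>x. x \<in> S \<Longrightarrow> (\<Sum>y\<in>S. q x y * (V y - V x)) \<le> - \<theta> * V x"
    and \<epsilon>: "\<epsilon> > 0"
  shows "\<forall>\<^sub>F h in at_right 0. \<forall>x\<in>S.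
    measure_pmf.expectation (P h x) V \<le> (1 - \<theta> * h) * V x + \<epsilon> * h"
proof (rule eventually_ball_finite[OF S], rule ballI)
  fix x assume x: "x \<in> S"
  have "((\<lambda>h. \<Sum>y\<in>S. pmf (P h x) y / h * (V y - V x)) \<longlongrightarrow> (\<Sum>y\<in>S. q x y * (V y - V x))) (at_right 0)"
  proof (rule tendsto_sum)
    fix y assume y: "y \<in> S"
    show "((\<lambda>h. pmf (P h x) y / h * (V y - V x)) \<longlongrightarrow> q x y * (V y - V x)) (at_right 0)"
    proof (cases "x = y")
      case False
      then show ?thesis
        using P x y unfolding transition_semigroup_def by (intro tendsto_mult_right) auto
    qed simp
  qed
  moreover have "(\<Sum>y\<in>S. q x y * (V y - V x)) < - \<theta> * V x + \<epsilon>"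
    using drift[OF x] \<epsilon> by simp
  ultimately have "\<forall>\<^sub>F h in at_right 0. (\<Sum>y\<in>S. pmf (P h x) y / h * (V y - V x)) < - \<theta> * V x + \<epsilon>"
    by (rule order_tendstoD)
  moreover have "\<forall>\<^sub>F h in at_right (0::real). h > 0"
    by (simp add: eventually_at_right_less)
  ultimately show "\<forall>\<^sub>F h in at_right 0.
    measure_pmf.expectation (P h x) V \<le> (1 - \<theta> * h) * V x + \<epsilon> * h"
  proof eventually_elim
    case (elim h)
    have supp: "set_pmf (P h x) \<subseteq> S"
      using P x elim(2) unfolding transition_semigroup_def by auto
    have "measure_pmf.expectation (P h x) V - V x = (\<Sum>y\<in>S. V y * pmf (P h x) y) - V x * (\<Sum>y\<in>S. pmf (P h x) y)"
      using supp S by (subst integral_measure_pmf_real[of S]) (auto simp: sum_pmf_eq_1)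
    also have "\<dots> = h * (\<Sum>y\<in>S. pmf (P h x) y / h * (V y - V x))"
      unfolding sum_distrib_left sum_subtractf[symmetric]
      using elim(2) by (intro sum.cong refl) (simp add: field_simps)
    also have "\<dots> \<le> h * (- \<theta> * V x + \<epsilon>)"
      using elim by (intro mult_left_mono) auto
    finally show ?case by (simp add: algebra_simps)
  qed
qed

text \<open>
  Cutting \<open>[0, t]\<close> into \<open>n\<close> steps of length \<open>h\<close> and iterating the short-time estimate gives
  \<open>(1 - \<theta> h)\<^sup>n V x + n \<epsilon> h\<close>. Here \<open>(1 - \<theta> h)\<^sup>n \<le> exp (- \<theta> t)\<close> and \<open>n \<epsilon> h = \<epsilon> t\<close>, which is arbitrarily small.
  In this way only the behaviour of the semigroup near time \<open>0\<close> enters.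
\<close>

lemma transition_semigroup_exp_decay:
  assumes P: "transition_semigroup S q P" and S: "finite S"
    and drift: "\<And>x. x \<in> S \<Longrightarrow> (\<Sum>y\<in>S. q x y * (V y - V x)) \<le> - \<theta> * V x"
    and V: "\<And>x. x \<in> S \<Longrightarrow> V x \<ge> 0" and \<theta>: "\<theta> \<ge> 0" and x: "x \<in> S" and t: "t \<ge> 0"
  shows "measure_pmf.expectation (P t x) V \<le> exp (- \<theta> * t) * V x"
proof (cases "t = 0")
  case True
  then show ?thesis using P x by (simp add: transition_semigroup_def)
next
  case False
  with t have t: "t > 0" by simp
  have supp: "set_pmf (P u y) \<subseteq> S" if "u \<ge> 0" "y \<in> S" for u y
    using P that by (simp add: transition_semigroup_def)
  have int: "integrable (P u y) g" if "u \<ge> 0" "y \<in> S" for u y and g :: "_ \<Rightarrow> real"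
    using supp[OF that] S by (intro integrable_measure_pmf_finite) (rule finite_subset)
  show ?thesis
  proof (rule field_le_epsilon)
    fix e :: real assume "e > 0"
    define \<epsilon> where "\<epsilon> = e / t"
    have \<epsilon>: "\<epsilon> > 0" using \<open>e > 0\<close> t by (simp add: \<epsilon>_def)
    obtain b where b: "b > 0" "\<And>h x. 0 < h \<Longrightarrow> h < b \<Longrightarrow> x \<in> S \<Longrightarrow>
        measure_pmf.expectation (P h x) V \<le> (1 - \<theta> * h) * V x + \<epsilon> * h"
      using transition_semigroup_short_time[OF P S drift \<epsilon>]
      unfolding eventually_at_right_field by auto
    \<comment> \<open>So many steps that the estimate applies to each one and \<open>1 - \<theta> h\<close> stays nonnegative.\<close>
    obtain n :: nat where n: "max (t / b) (\<theta> * t) < real n"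
      using reals_Archimedean2 by blast
    define h where "h = t / real n"
    have "t / b > 0" using t b(1) by simp
    with n have "real n > 0" by linarith
    then have h: "h > 0" "h < b" "\<theta> * h \<le> 1" "real n * h = t"
      using n t b(1) by (auto simp: h_def field_simps)
    have iter: "measure_pmf.expectation (P (real m * h) x) V \<le> (1 - \<theta> * h) ^ m * V x + real m * (\<epsilon> * h)" for m
    proof (induction m)
      case 0
      then show ?case using P x by (simp add: transition_semigroup_def)
    next
      case (Suc m)
      let ?p = "P (real m * h) x"
      have mh: "real m * h \<ge> 0" using h by simp
      have "P (real (Suc m) * h) x = bind_pmf ?p (P h)"
      proof -
        have "P (real m * h + h) x = bind_pmf ?p (P h)"
          using P x mh h(1) unfolding transition_semigroup_def by simp
        then show ?thesis by (simp add: algebra_simps)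
      qed
      then have "measure_pmf.expectation (P (real (Suc m) * h) x) V
          = (\<Sum>y\<in>S. pmf ?p y *\<^sub>R measure_pmf.expectation (P h y) V)"
        using supp[OF mh x] supp[of h] S h(1)
        by (simp add: pmf_expectation_bind[OF S] finite_subset[OF _ S])
      also have "\<dots> \<le> (\<Sum>y\<in>S. pmf ?p y *\<^sub>R ((1 - \<theta> * h) * V y + \<epsilon> * h))"
        using b(2)[OF h(1,2)] by (intro sum_mono scaleR_left_mono) auto
      also have "\<dots> = (1 - \<theta> * h) * (\<Sum>y\<in>S. V y * pmf ?p y) + (\<Sum>y\<in>S. pmf ?p y) * (\<epsilon> * h)"
        unfolding sum_distrib_left sum_distrib_right sum.distrib[symmetric]
        by (intro sum.cong refl) (simp add: algebra_simps)
      also have "\<dots> = (1 - \<theta> * h) * measure_pmf.expectation ?p V + \<epsilon> * h"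
        using supp[OF mh x] S by (subst integral_measure_pmf_real[of S]) (auto simp: sum_pmf_eq_1)
      also have "\<dots> \<le> (1 - \<theta> * h) * ((1 - \<theta> * h) ^ m * V x + real m * (\<epsilon> * h)) + \<epsilon> * h"
        using Suc h by (intro add_right_mono mult_left_mono) auto
      also have "\<dots> \<le> (1 - \<theta> * h) ^ Suc m * V x + real (Suc m) * (\<epsilon> * h)"
      proof -
        have "(1 - \<theta> * h) * (real m * (\<epsilon> * h)) \<le> 1 * (real m * (\<epsilon> * h))"
          using \<theta> \<epsilon> h by (intro mult_right_mono) auto
        then show ?thesis by (simp add: algebra_simps)
      qed
      finally show ?case .
    qed
    have "(1 - \<theta> * h) ^ n \<le> exp (- \<theta> * h) ^ n"
      using h exp_ge_add_one_self[of "- \<theta> * h"] by (intro power_mono) auto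
    also have "\<dots> = exp (- \<theta> * t)"
      using h(4) by (simp add: exp_of_nat_mult[symmetric] algebra_simps)
    finally have "(1 - \<theta> * h) ^ n * V x \<le> exp (- \<theta> * t) * V x"
      using V[OF x] by (intro mult_right_mono)
    moreover have "real n * (\<epsilon> * h) = e"
      using h(4) t by (simp add: \<epsilon>_def field_simps)
    ultimately show "measure_pmf.expectation (P t x) V \<le> exp (- \<theta> * t) * V x + e"
      using iter[of n] h(4) by simp
  qed
qed

text \<open>
  The bound \<open>C\<close> on \<open>V\<close> absorbs the law of the initial state, over which the semigroup estimate
  is averaged.
\<close>

lemma markov_jump_process_exp_decay:
  assumes X: "markov_jump_process S q \<nu> M X"
    and drift: "\<And>x. x \<in> S \<Longrightarrow> (\<Sum>y\<in>S. q x y * (V y - V x)) \<le> - \<theta> * V x"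
    and V: "\<And>x. x \<in> S \<Longrightarrow> V x \<ge> 0" "\<And>x. x \<in> S \<Longrightarrow> V x \<le> C"
    and \<theta>: "\<theta> \<ge> 0" and t: "t \<ge> 0"
  shows "integrable M (\<lambda>\<omega>. V (X t \<omega>))"
    and "integral\<^sup>L M (\<lambda>\<omega>. V (X t \<omega>)) \<le> C * exp (- \<theta> * t)"
proof -
  have S: "finite S" and "prob_space M"
    using X by (simp_all add: markov_jump_process_def)
  interpret prob_space M by fact
  have meas: "X u \<in> measurable M (count_space UNIV)" and range: "X u \<in> space M \<rightarrow> S" if "u \<ge> 0" for u
    using X that by (simp_all add: markov_jump_process_def)
  obtain P where P: "transition_semigroup S q P"
    and trans: "\<And>s h E x y. s \<ge> 0 \<Longrightarrow> h \<ge> 0 \<Longrightarrow> E \<in> past_events M X s \<Longrightarrow> x \<in> S \<Longrightarrow> y \<in> S \<Longrightarrow>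
           prob (E \<inter> {\<omega> \<in> space M. X s \<omega> = x \<and> X (s + h) \<omega> = y}) =
           prob (E \<inter> {\<omega> \<in> space M. X s \<omega> = x}) * pmf (P h x) y"
    using X unfolding markov_jump_process_def by blast
  define A where "A u x = {\<omega> \<in> space M. X u \<omega> = x}" for u x
  have A[measurable]: "A u x \<in> sets M" if "u \<ge> 0" for u x
  proof -
    have "A u x = X u -` {x} \<inter> space M" by (auto simp: A_def)
    then show ?thesis using measurable_sets[OF meas[OF that], of "{x}"] by simp
  qed
  have joint: "prob (A 0 x \<inter> A t y) = prob (A 0 x) * pmf (P t x) y" if "x \<in> S" "y \<in> S" for x y
  proof -
    have "space M \<in> past_events M X 0"
      unfolding past_events_def by (rule sigma_sets_top)
    from trans[OF order_refl t this that] show ?thesis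
      by (simp add: A_def Int_absorb1 Collect_conj_eq[symmetric] Int_def conj_ac cong: conj_cong)
  qed
  have Vt: "V (X t \<omega>) = (\<Sum>x\<in>S. \<Sum>y\<in>S. V y * indicat_real (A 0 x \<inter> A t y) \<omega>)" if "\<omega> \<in> space M" for \<omega>
  proof -
    have "(\<Sum>x\<in>S. \<Sum>y\<in>S. V y * indicat_real (A 0 x \<inter> A t y) \<omega>)
        = (\<Sum>x\<in>S. \<Sum>y\<in>S. if y = X t \<omega> then (if x = X 0 \<omega> then V (X t \<omega>) else 0) else 0)"
      using that by (intro sum.cong refl) (auto simp: A_def indicator_def)
    moreover have "X t \<omega> \<in> S" "X 0 \<omega> \<in> S"
      using that range[OF t] range[of 0] by auto
    ultimately show ?thesis
      using S by (simp only: sum.delta if_True)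
  qed
  have integrable: "integrable M (\<lambda>\<omega>. V y * indicat_real (A 0 x \<inter> A t y) \<omega>)" for x y
    using t by (intro integrable_mult_right integrable_real_indicator) (auto simp: emeasure_eq_measure)
  have "integrable M (\<lambda>\<omega>. \<Sum>x\<in>S. \<Sum>y\<in>S. V y * indicat_real (A 0 x \<inter> A t y) \<omega>)"
    using integrable by (intro Bochner_Integration.integrable_sum)
  then show "integrable M (\<lambda>\<omega>. V (X t \<omega>))"
    by (subst Bochner_Integration.integrable_cong[OF refl Vt]) 
  have "integral\<^sup>L M (\<lambda>\<omega>. V (X t \<omega>)) = (\<Sum>x\<in>S. \<Sum>y\<in>S. V y * prob (A 0 x \<inter> A t y))"
    using integrable t
    by (subst Bochner_Integration.integral_cong[OF refl Vt])
      (auto simp: Bochner_Integration.integral_sum Bochner_Integration.integrable_sum)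
  also have "\<dots> = (\<Sum>x\<in>S. prob (A 0 x) * (\<Sum>y\<in>S. V y * pmf (P t x) y))"
    by (intro sum.cong refl) (simp add: joint sum_distrib_left mult_ac)
  also have "\<dots> = (\<Sum>x\<in>S. prob (A 0 x) * measure_pmf.expectation (P t x) V)"
  proof (intro sum.cong refl)
    fix x assume "x \<in> S"
    then have "set_pmf (P t x) \<subseteq> S"
      using P t by (simp add: transition_semigroup_def)
    then show "prob (A 0 x) * (\<Sum>y\<in>S. V y * pmf (P t x) y) = prob (A 0 x) * measure_pmf.expectation (P t x) V"
      using S by (subst integral_measure_pmf_real[of S]) auto
  qed
  also have "\<dots> \<le> (\<Sum>x\<in>S. prob (A 0 x) * (C * exp (- \<theta> * t)))"
  proof (intro sum_mono mult_left_mono)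
    fix x assume x: "x \<in> S"
    have "measure_pmf.expectation (P t x) V \<le> exp (- \<theta> * t) * V x"
      by (rule transition_semigroup_exp_decay[OF P S drift V(1) \<theta> x t])
    also have "\<dots> \<le> exp (- \<theta> * t) * C"
      using V(2)[OF x] by simp
    finally show "measure_pmf.expectation (P t x) V \<le> C * exp (- \<theta> * t)"
      by (simp add: mult.commute)
  qed simp
  also have "\<dots> = (\<Sum>x\<in>S. prob (A 0 x)) * (C * exp (- \<theta> * t))"
    by (simp add: sum_distrib_right)
  also have "(\<Sum>x\<in>S. prob (A 0 x)) = prob (\<Union>x\<in>S. A 0 x)"
    using S A by (intro finite_measure_finite_Union[symmetric]) (auto simp: disjoint_family_on_def A_def)
  also have "(\<Union>x\<in>S. A 0 x) = space M"
    using range[of 0] by (auto simp: A_def)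
  finally show "integral\<^sup>L M (\<lambda>\<omega>. V (X t \<omega>)) \<le> C * exp (- \<theta> * t)"
    by (simp add: prob_space)
qed

section \<open>The number of copies of one file\<close>

lemma least_replicated_holds_file:
  "f \<in> least_replicated Fs A i \<Longrightarrow> f \<in> Fs \<and> i \<in> A f"
  by (simp add: least_replicated_def is_arg_min_def)

lemma duplicate_from_copies:
  assumes "finite Fs" and "N > 0" and "B \<in> set_pmf (duplicate_from d N Fs A i)"
  shows "B f = A f \<or> (i \<in> A f \<and> (\<exists>j. B f = insert j (A f)))"
proof (cases "\<exists>f\<in>least_replicated Fs A i. card (A f) < d")
  case True
  have "least_replicated Fs A i \<noteq> {}"
    using True by auto
  moreover have "finite (least_replicated Fs A i)"
    by (rule finite_subset[OF _ assms(1)]) (auto simp: least_replicated_def is_arg_min_def)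
  ultimately have "set_pmf (pmf_of_set (least_replicated Fs A i)) = least_replicated Fs A i"
    by (rule set_pmf_of_set)
  with True assms(3) obtain g j where "g \<in> least_replicated Fs A i" "B = A(g := insert j (A g))"
    unfolding duplicate_from_def by (subst (asm) if_P) auto
  then show ?thesis using least_replicated_holds_file[of g Fs A i] by auto
next
  case False
  then show ?thesis using assms(3) by (simp add: duplicate_from_def)
qed

lemma fail_node_in_configs: "A \<in> configs d N Fs \<Longrightarrow> fail_node i A \<in> configs d N Fs"
  unfolding configs_def PiE_dflt_def fail_node_def
  by (auto intro: order_trans[OF card_Diff1_le])

text \<open>
  Summation over the nodes that hold \<open>f\<close>: each of them fails at rate \<open>\<mu>\<close> and then removes one
  copy; each of them duplicates at rate \<open>\<lambda>\<close>, and since this creates at most one copy of \<open>f\<close>, it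
  contributes at most the increment of \<open>w\<close>, which is assumed to be nonnegative. The other nodes
  do not change the number of copies of \<open>f\<close>.
\<close>

lemma network_drift_le:
  fixes w :: "nat \<Rightarrow> real"
  assumes Fs: "finite Fs" and N: "N > 0" and lam: "lam \<ge> 0"
    and A: "A \<in> configs d N Fs" and f: "f \<in> Fs" and finite: "finite (configs d N Fs)"
    and incr: "w (card (A f)) \<le> w (Suc (card (A f)))"
  shows "(\<Sum>B\<in>configs d N Fs. network_rate d lam mu N Fs A B * (w (card (B f)) - w (card (A f))))
     \<le> mu * real (card (A f)) * (w (card (A f) - 1) - w (card (A f)))
       + lam * real (card (A f)) * (w (Suc (card (A f))) - w (card (A f)))"
proof -
  let ?c = "card (A f)" and ?S = "configs d N Fs"
  let ?g = "\<lambda>B :: 'a config. w (card (B f)) - w ?c"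
  let ?I = "{i\<in>{1..N}. \<exists>f\<in>Fs. i \<in> A f}"
  have Af: "A f \<subseteq> {1..N}"
    using A f by (auto simp: configs_def PiE_dflt_def)
  then have fin: "finite (A f)" by (rule finite_subset) simp
  have count: "(\<Sum>i\<in>{1..N}. if i \<in> A f then r else 0) = real ?c * r" for r :: real
    using Af by (simp add: sum.inter_restrict[symmetric] Int_absorb1)
  have failures: "(\<Sum>B\<in>?S. (\<Sum>i\<in>{1..N}. mu * of_bool (fail_node i A = B)) * ?g B)
      = mu * real ?c * (w (?c - 1) - w ?c)"
  proof -
    have "(\<Sum>B\<in>?S. (\<Sum>i\<in>{1..N}. mu * of_bool (fail_node i A = B)) * ?g B)
        = (\<Sum>i\<in>{1..N}. \<Sum>B\<in>?S. mu * of_bool (fail_node i A = B) * ?g B)"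
      by (subst sum.swap) (simp only: sum_distrib_right)
    also have "\<dots> = (\<Sum>i\<in>{1..N}. \<Sum>B\<in>?S. if fail_node i A = B then mu * ?g (fail_node i A) else 0)"
      by (intro sum.cong refl) auto
    also have "\<dots> = (\<Sum>i\<in>{1..N}. mu * ?g (fail_node i A))"
      using finite fail_node_in_configs[OF A] by simp
    also have "\<dots> = (\<Sum>i\<in>{1..N}. if i \<in> A f then mu * (w (?c - 1) - w ?c) else 0)"
      using fin by (intro sum.cong refl) (auto simp: fail_node_def card_Diff_singleton)
    also have "\<dots> = mu * real ?c * (w (?c - 1) - w ?c)"
      unfolding count by simp
    finally show ?thesis .
  qed
  have one_node: "(\<Sum>B\<in>?S. pmf (duplicate_from d N Fs A i) B * ?g B)
      \<le> (if i \<in> A f then w (Suc ?c) - w ?c else 0)" for i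
  proof -
    let ?r = "if i \<in> A f then w (Suc ?c) - w ?c else 0" and ?p = "duplicate_from d N Fs A i"
    have "(\<Sum>B\<in>?S. pmf ?p B * ?g B) \<le> (\<Sum>B\<in>?S. pmf ?p B * ?r)"
    proof (rule sum_mono)
      fix B
      show "pmf ?p B * ?g B \<le> pmf ?p B * ?r"
      proof (cases "B \<in> set_pmf ?p")
        case True
        then have "?g B \<le> ?r"
          using duplicate_from_copies[OF Fs N True, of f] incr fin
          by (auto simp: card_insert_if split: if_splits)
        then show ?thesis by (simp add: mult_left_mono)
      qed (simp add: set_pmf_iff)
    qed
    also have "\<dots> = measure_pmf.prob ?p ?S * ?r"
      using finite by (simp add: sum_distrib_right measure_measure_pmf_finite)
    also have "\<dots> \<le> 1 * ?r"
      using incr by (intro mult_right_mono) auto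
    finally show ?thesis by simp
  qed
  have "(\<Sum>B\<in>?S. (\<Sum>i\<in>?I. lam * pmf (duplicate_from d N Fs A i) B) * ?g B)
      = (\<Sum>i\<in>?I. lam * (\<Sum>B\<in>?S. pmf (duplicate_from d N Fs A i) B * ?g B))"
    by (simp only: sum_distrib_right sum_distrib_left) (subst sum.swap, simp add: mult_ac)
  also have "\<dots> \<le> (\<Sum>i\<in>?I. lam * (if i \<in> A f then w (Suc ?c) - w ?c else 0))"
    using lam one_node by (intro sum_mono mult_left_mono)
  also have "\<dots> \<le> (\<Sum>i\<in>{1..N}. lam * (if i \<in> A f then w (Suc ?c) - w ?c else 0))"
    using lam incr by (intro sum_mono2) auto
  also have "\<dots> = lam * real ?c * (w (Suc ?c) - w ?c)"
    by (simp only: sum_distrib_left[symmetric] count mult.assoc)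
  finally have duplications: "(\<Sum>B\<in>?S. (\<Sum>i\<in>?I. lam * pmf (duplicate_from d N Fs A i) B) * ?g B)
      \<le> lam * real ?c * (w (Suc ?c) - w ?c)" .
  show ?thesis
    using failures duplications
    by (simp add: network_rate_def distrib_right sum.distrib)
qed

section \<open>The number of files alive\<close>

text \<open>
  Up to the factor \<open>\<mu>\<close>, the right-hand side of the drift bound is the eigenvalue equation of
  \<open>bd_eigen\<close>, whose values \<open>w k \<ge> 1\<close> for \<open>1 \<le> k \<le> d\<close> dominate the indicator that the file is alive.
\<close>

lemma expected_alive_files_le:
  assumes lam: "lam > 0" and mu: "mu > 0" and N: "N > 0" and Fs: "finite Fs"
    and X: "network_process d lam mu N Fs M X" and t: "t \<ge> 0"
    and s: "s \<ge> 0" "\<And>k. k \<le> d \<Longrightarrow> bd_eigen (lam / mu) s k \<le> bd_eigen (lam / mu) s (Suc k)"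
  shows "integral\<^sup>L M (\<lambda>\<omega>. alive_files Fs (X t \<omega>))
    \<le> real (card Fs) * (bd_eigen (lam / mu) s d * exp (- mu * s * t))"
proof -
  let ?\<rho> = "lam / mu" and ?S = "configs d N Fs"
  let ?w = "bd_eigen ?\<rho> s"
  have \<rho>: "?\<rho> > 0" using lam mu by simp
  have jump: "markov_jump_process ?S (network_rate d lam mu N Fs) (initial_config d N Fs) M X"
    using X by (simp add: network_process_def)
  then have "prob_space M" and range: "X t \<in> space M \<rightarrow> ?S" and finite: "finite ?S"
    using t by (simp_all add: markov_jump_process_def)
  interpret prob_space M by fact
  have w_pos: "?w k \<ge> 1" if "0 < k" "k \<le> d" for k
    by (rule bd_eigen_ge_1) (use s(2) that in auto)
  have w_le: "?w k \<le> ?w d" if "k \<le> d" for k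
    using that
  proof (induction rule: inc_induct)
    case (step n)
    then show ?case using s(2)[of n] by simp
  qed simp
  have copies: "A f \<subseteq> {1..N} \<and> card (A f) \<le> d" if "A \<in> ?S" "f \<in> Fs" for A f
    using that by (auto simp: configs_def PiE_dflt_def)
  have file_bound: "integrable M (\<lambda>\<omega>. ?w (card (X t \<omega> f)))"
      "integral\<^sup>L M (\<lambda>\<omega>. ?w (card (X t \<omega> f))) \<le> ?w d * exp (- (mu * s) * t)" if f: "f \<in> Fs" for f
  proof -
    have drift: "(\<Sum>B\<in>?S. network_rate d lam mu N Fs A B * (?w (card (B f)) - ?w (card (A f))))
        \<le> - (mu * s) * ?w (card (A f))" if A: "A \<in> ?S" for A
    proof -
      let ?c = "card (A f)"
      have "(\<Sum>B\<in>?S. network_rate d lam mu N Fs A B * (?w (card (B f)) - ?w ?c))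
        \<le> mu * real ?c * (?w (?c - 1) - ?w ?c) + lam * real ?c * (?w (Suc ?c) - ?w ?c)"
        using copies[OF A f] s(2) lam by (intro network_drift_le Fs N A f finite) auto
      also have "\<dots> = mu * (real ?c * ?\<rho> * (?w (Suc ?c) - ?w ?c) + real ?c * (?w (?c - 1) - ?w ?c))"
        using mu by (simp add: field_simps)
      also have "\<dots> = mu * (- s * ?w ?c)"
      proof (cases "?c = 0")
        case False
        then show ?thesis by (subst bd_eigen_generator[OF \<rho>]) auto
      qed simp
      finally show ?thesis by simp
    qed
    have nonneg: "?w (card (A f)) \<ge> 0" if "A \<in> ?S" for A
      using w_pos[of "card (A f)"] copies[OF that f] by (cases "card (A f) = 0") auto
    have bound: "?w (card (A f)) \<le> ?w d" if "A \<in> ?S" for A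
      using w_le copies[OF that f] by simp
    have \<theta>: "mu * s \<ge> 0" using mu s(1) by simp
    note decay = markov_jump_process_exp_decay[OF jump,
        where V = "\<lambda>A. ?w (card (A f))" and \<theta> = "mu * s" and C = "?w d" and t = t]
    show "integrable M (\<lambda>\<omega>. ?w (card (X t \<omega> f)))"
      by (rule decay(1)) (erule drift, erule nonneg, erule bound, rule \<theta>, rule t)
    show "integral\<^sup>L M (\<lambda>\<omega>. ?w (card (X t \<omega> f))) \<le> ?w d * exp (- (mu * s) * t)"
      by (rule decay(2)) (erule drift, erule nonneg, erule bound, rule \<theta>, rule t)
  qed
  have "integral\<^sup>L M (\<lambda>\<omega>. alive_files Fs (X t \<omega>)) \<le> integral\<^sup>L M (\<lambda>\<omega>. \<Sum>f\<in>Fs. ?w (card (X t \<omega> f)))"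
  proof (rule integral_mono')
    fix \<omega> assume \<omega>: "\<omega> \<in> space M"
    with range have A: "X t \<omega> \<in> ?S" by auto
    show "alive_files Fs (X t \<omega>) \<le> (\<Sum>f\<in>Fs. ?w (card (X t \<omega> f)))"
      unfolding alive_files_def
    proof (rule sum_mono)
      fix f assume f: "f \<in> Fs"
      have "finite (X t \<omega> f)"
        using copies[OF A f] finite_subset by blast
      then show "of_bool (X t \<omega> f \<noteq> {}) \<le> ?w (card (X t \<omega> f))"
        using w_pos[of "card (X t \<omega> f)"] copies[OF A f] by (cases "X t \<omega> f = {}") (auto simp: card_gt_0_iff)
    qed
    then show "0 \<le> (\<Sum>f\<in>Fs. ?w (card (X t \<omega> f)))"
      by (rule order_trans[rotated]) (simp add: alive_files_def sum_nonneg)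
  qed (use file_bound in \<open>intro Bochner_Integration.integrable_sum\<close>)
  also have "\<dots> = (\<Sum>f\<in>Fs. integral\<^sup>L M (\<lambda>\<omega>. ?w (card (X t \<omega> f))))"
    using file_bound by (intro Bochner_Integration.integral_sum)
  also have "\<dots> \<le> (\<Sum>f\<in>Fs. ?w d * exp (- (mu * s) * t))"
    using file_bound by (intro sum_mono)
  finally show ?thesis by simp
qed

theorem proposition6:
  fixes d :: nat and lam mu rho \<beta> :: real
    and Fs :: "nat \<Rightarrow> 'f set"
    and M :: "nat \<Rightarrow> 'w measure"
    and X :: "nat \<Rightarrow> real \<Rightarrow> 'w \<Rightarrow> 'f config"
  assumes "d \<ge> 2" and "lam > 0" and "mu > 0" and "rho = lam / mu"
    and "\<And>N. finite (Fs N)"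
    and "\<beta> > 0" and "(\<lambda>N. real (card (Fs N)) / real N) \<longlonglongrightarrow> \<beta>"
    and "\<And>N. N \<ge> d \<Longrightarrow> network_process d lam mu N (Fs N) (M N) (X N)"
  shows "\<exists>K1>0. \<forall>t\<ge>0.
    limsup (\<lambda>N. ereal (integral\<^sup>L (M N) (\<lambda>\<omega>. alive_files (Fs N) (X N t \<omega>) / real N)))
      \<le> ereal (K1 * exp (- mu * kappa_plus d rho * t))"
proof -
  have rho: "rho > 0" and d: "d > 0" using assms(1-4) by simp_all
  obtain s where s: "s > 0" and mono: "\<And>k. k \<le> d \<Longrightarrow> bd_eigen rho s k \<le> bd_eigen rho s (Suc k)"
    and closing: "bd_eigen rho s (Suc d) = bd_eigen rho s d"
    using increasing_bd_eigen_exists[OF rho d] by metis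
  have kappa: "kappa_plus d rho \<le> s"
    by (intro kappa_plus_le eigenvalue_M_rho_bd_eigen rho d closing)
  have w_pos: "bd_eigen rho s d \<ge> 1"
    by (rule bd_eigen_ge_1) (use mono d in auto)
  define K where "K = \<beta> * bd_eigen rho s d"
  have "limsup (\<lambda>N. ereal (integral\<^sup>L (M N) (\<lambda>\<omega>. alive_files (Fs N) (X N t \<omega>) / real N)))
      \<le> ereal (K * exp (- mu * kappa_plus d rho * t))" if t: "t \<ge> 0" for t
  proof -
    let ?b = "bd_eigen rho s d * exp (- mu * s * t)"
    have "integral\<^sup>L (M N) (\<lambda>\<omega>. alive_files (Fs N) (X N t \<omega>) / real N)
        \<le> real (card (Fs N)) / real N * ?b" if N: "N \<ge> d" for N
    proof -
      have "integral\<^sup>L (M N) (\<lambda>\<omega>. alive_files (Fs N) (X N t \<omega>)) \<le> real (card (Fs N)) * ?b"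
        unfolding assms(4)
        using assms N d s mono t by (intro expected_alive_files_le[where N = N and d = d]) auto
      then have "integral\<^sup>L (M N) (\<lambda>\<omega>. alive_files (Fs N) (X N t \<omega>)) / real N
          \<le> real (card (Fs N)) * ?b / real N"
        by (rule divide_right_mono) simp
      then show ?thesis by simp
    qed
    then have "\<forall>\<^sub>F N in sequentially.
        ereal (integral\<^sup>L (M N) (\<lambda>\<omega>. alive_files (Fs N) (X N t \<omega>) / real N))
        \<le> ereal (real (card (Fs N)) / real N * ?b)"
      unfolding eventually_sequentially by (intro exI[of _ d]) simp
    then have "limsup (\<lambda>N. ereal (integral\<^sup>L (M N) (\<lambda>\<omega>. alive_files (Fs N) (X N t \<omega>) / real N)))
        \<le> limsup (\<lambda>N. ereal (real (card (Fs N)) / real N * ?b))"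
      by (rule Limsup_mono)
    also have "\<dots> = ereal (\<beta> * ?b)"
      by (intro lim_imp_Limsup tendsto_ereal tendsto_mult_right assms(7)) simp
    also have "\<dots> \<le> ereal (K * exp (- mu * kappa_plus d rho * t))"
      using kappa t assms(3,6) w_pos
      by (auto simp: K_def mult.assoc intro!: mult_left_mono mult_right_mono)
    finally show ?thesis .
  qed
  moreover have "K > 0"
    using assms(6) w_pos by (simp add: K_def)
  ultimately show ?thesis by blast
qed

end
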